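(* Let $\mathbf{d}$ be a distance on a set $X$ such that $X$ is a $\mathbf{d}$-$\max$-predomain, and let $B\subseteq X$ be a $\mathbf{d}$-$\max$-basis of $X$. Then $\mathcal{I}^{\mathbf{d}}(B)$ is a $\mathbf{d}^{\mathcal{H}}$-$\max$-domain and $$x\mapsto(\leq^{\mathbf{d}}x)\cap B$$ is an isometry from $X$ (with $\mathbf{d}$) to $\mathcal{I}^{\mathbf{d}}(B)$ (with $\mathbf{d}^{\mathcal{H}}$). Moreover, this isometry is onto $\mathcal{I}^{\mathbf{d}}(B)$ if and only if $X$ is a $\mathbf{d}$-$\max$-domain.
   Context: Suprema and infima are taken in $[0,\infty]$, with $\sup\emptyset=0$, $\inf\emptyset=\infty$; for $a,b\in[0,\infty]$, $(a-b)_+=\min\{c\in[0,\infty]:a\leq b+c\}$. A distance on $X$ is a function $\mathbf{d}:X\times X\to[0,\infty]$, written $x\mathbf{d}y$, with $x\mathbf{d}z\leq x\mathbf{d}y+y\mathbf{d}z$ for all $x,y,z$ (no symmetry, and $x\mathbf{d}x=0$ is not required). Functions are ordered pointwise. The upper and lower hemimetrics are $x\overline{\mathbf{d}}z=\sup_{y\in X}(x\mathbf{d}y-z\mathbf{d}y)_+$ and $z\underline{\mathbf{d}}y=\sup_{x\in X}(x\mathbf{d}y-x\mathbf{d}z)_+$. Write $(\leq^{\mathbf{d}}x)=\{y\in X:y\mathbf{d}x=0\}$. $Y\subseteq X$ is $\mathbf{d}$-directed if $\inf_{y\in Y}\sup_{z\in F}z\mathbf{d}y=0$ for every finite $F\subseteq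 Y$ (so $Y\neq\emptyset$). $x$ is a $\mathbf{d}$-maximum of $Y$ if $y\mathbf{d}x=0$ for all $y\in Y$ and $\inf_{y\in Y}z\mathbf{d}y\leq z\mathbf{d}x$ for all $z\in X$. $X$ is $\mathbf{d}$-$\max$-complete if every $\mathbf{d}$-directed subset of $X$ has a $\mathbf{d}$-maximum in $X$. $B\subseteq X$ is a $\mathbf{d}$-$\max$-basis of $X$ if every $x\in X$ is a $\mathbf{d}$-maximum of some $\mathbf{d}$-directed $Y\subseteq B$; $X$ is $\mathbf{d}$-$\max$-continuous if $X$ is a $\mathbf{d}$-$\max$-basis of itself. $X$ is a $\mathbf{d}$-$\max$-predomain if it is $\mathbf{d}$-$\max$-continuous and $\overline{\mathbf{d}}\leq\underline{\mathbf{d}}$; it is a $\mathbf{d}$-$\max$-domain if moreover it is $\mathbf{d}$-$\max$-complete. A $\mathbf{d}$-ideal of $X$ is a $\mathbf{d}$-directed subset of $X$ that is closed in the topology $\overline{\mathbf{d}}^\bullet$ generated by the balls $\{x\in X:c\overline{\mathbf{d}}x<r\}$ ($c\in X$, $r>0$). $\mathcal{I}^{\mathbf{d}}(B)$ is the set of $\mathbf{d}$-ideals of $B$, i.e. this notion applied to the set $B$ with the restricted distance $\mathbf{d}|_B$. For sets $Y,Z$, $Y\mathbf{d}^{\mathcal{H}}Z=\inf_{z\in Z}\sup_{y\in Y}y\mathbf{d}z$, which is a distance on families of subsets; "$\mathcal{I}^{\mathbf{d}}(B)$ is a $\mathbf{d}^{\mathcal{H}}$-$\max$-domain" refers to $\mathcal{I}^{\mathbf{d}}(B)$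 with the restriction of $\mathbf{d}^{\mathcal{H}}$. An isometry $f$ is a map preserving distances, i.e. $f(x)\,\mathbf{d}^{\mathcal{H}}f(y)=x\mathbf{d}y$ for all $x,y\in X$ (not assumed injective). *)

theory Defs
  imports "HOL-Analysis.Analysis"
begin

text \<open>
  A set \<open>X\<close> with a distance is a carrier \<open>X :: 'a set\<close> together with \<open>d :: 'a \<Rightarrow> 'a \<Rightarrow> ennreal\<close>,
  of which only the values on \<open>X\<close> matter.  Thus passing to the restriction of \<open>d\<close> to a subset
  \<open>B\<close> means replacing the carrier by \<open>B\<close>.  On \<^typ>\<open>ennreal\<close> the conventions
  \<open>Sup {} = 0\<close> and \<open>Inf {} = \<infinity>\<close> hold.
\<close>

text \<open>
  The truncated difference \<open>(a - b)\<^sub>+\<close>.  It is not subtraction on \<^typ>\<open>ennreal\<close>, for which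
  \<open>\<infinity> - \<infinity> = \<infinity>\<close>; here \<open>(\<infinity> - \<infinity>)\<^sub>+ = 0\<close>.
\<close>

definition pos_diff :: "ennreal \<Rightarrow> ennreal \<Rightarrow> ennreal" where
  "pos_diff a b = (LEAST c. a \<le> b + c)"

lemma pos_diff_le_iff: "pos_diff a b \<le> c \<longleftrightarrow> a \<le> b + c"
proof -
  define m where "m = (if b = top then 0 else a - b)"
  have m: "m \<le> c \<longleftrightarrow> a \<le> b + c" for c
    by (auto simp: m_def ennreal_minus_le_iff)
  have "pos_diff a b = m"
    unfolding pos_diff_def by (rule Least_equality) (auto simp flip: m)
  then show ?thesis by (simp add: m)
qed

lemma le_add_pos_diff: "a \<le> b + pos_diff a b"
  by (simp flip: pos_diff_le_iff)

definition distance_on :: "'a set \<Rightarrow> ('a \<Rightarrow> 'a \<Rightarrow> ennreal) \<Rightarrow> bool" where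
  "distance_on X d \<longleftrightarrow> (\<forall>x\<in>X. \<forall>y\<in>X. \<forall>z\<in>X. d x z \<le> d x y + d y z)"

definition upper_hemimetric :: "'a set \<Rightarrow> ('a \<Rightarrow> 'a \<Rightarrow> ennreal) \<Rightarrow> 'a \<Rightarrow> 'a \<Rightarrow> ennreal" where
  "upper_hemimetric X d x z = (SUP y\<in>X. pos_diff (d x y) (d z y))"

definition lower_hemimetric :: "'a set \<Rightarrow> ('a \<Rightarrow> 'a \<Rightarrow> ennreal) \<Rightarrow> 'a \<Rightarrow> 'a \<Rightarrow> ennreal" where
  "lower_hemimetric X d z y = (SUP x\<in>X. pos_diff (d x y) (d x z))"

definition d_directed :: "('a \<Rightarrow> 'a \<Rightarrow> ennreal) \<Rightarrow> 'a set \<Rightarrow> bool" where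
  "d_directed d Y \<longleftrightarrow> (\<forall>F. finite F \<and> F \<subseteq> Y \<longrightarrow> (INF y\<in>Y. SUP z\<in>F. d z y) = 0)"

lemma d_directed_nonempty: "d_directed d Y \<Longrightarrow> Y \<noteq> {}"
  unfolding d_directed_def by force

definition is_d_maximum :: "'a set \<Rightarrow> ('a \<Rightarrow> 'a \<Rightarrow> ennreal) \<Rightarrow> 'a set \<Rightarrow> 'a \<Rightarrow> bool" where
  "is_d_maximum X d Y x \<longleftrightarrow>
     x \<in> X \<and> (\<forall>y\<in>Y. d y x = 0) \<and> (\<forall>z\<in>X. (INF y\<in>Y. d z y) \<le> d z x)"

definition max_complete :: "'a set \<Rightarrow> ('a \<Rightarrow> 'a \<Rightarrow> ennreal) \<Rightarrow> bool" where
  "max_complete X d \<longleftrightarrow> (\<forall>Y. Y \<subseteq> X \<and> d_directed d Y \<longrightarrow> (\<exists>x. is_d_maximum X d Y x))"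

definition max_basis :: "'a set \<Rightarrow> ('a \<Rightarrow> 'a \<Rightarrow> ennreal) \<Rightarrow> 'a set \<Rightarrow> bool" where
  "max_basis X d B \<longleftrightarrow>
     B \<subseteq> X \<and> (\<forall>x\<in>X. \<exists>Y. Y \<subseteq> B \<and> d_directed d Y \<and> is_d_maximum X d Y x)"

definition max_continuous :: "'a set \<Rightarrow> ('a \<Rightarrow> 'a \<Rightarrow> ennreal) \<Rightarrow> bool" where
  "max_continuous X d \<longleftrightarrow> max_basis X d X"

definition max_predomain :: "'a set \<Rightarrow> ('a \<Rightarrow> 'a \<Rightarrow> ennreal) \<Rightarrow> bool" where
  "max_predomain X d \<longleftrightarrow>
     distance_on X d \<and> max_continuous X d \<and>
     (\<forall>x\<in>X. \<forall>y\<in>X. upper_hemimetric X d x y \<le> lower_hemimetric X d x y)"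

definition max_domain :: "'a set \<Rightarrow> ('a \<Rightarrow> 'a \<Rightarrow> ennreal) \<Rightarrow> bool" where
  "max_domain X d \<longleftrightarrow> max_predomain X d \<and> max_complete X d"

text \<open>
  The topology generated by the balls as a subbasis.  Radius \<open>\<infinity>\<close> is harmless: that ball is the
  union of the balls of finite radius about the same centre.
\<close>

definition upper_ball_topology :: "'a set \<Rightarrow> ('a \<Rightarrow> 'a \<Rightarrow> ennreal) \<Rightarrow> 'a topology" where
  "upper_ball_topology X d =
     topology_generated_by {{x \<in> X. upper_hemimetric X d c x < r} | c r. c \<in> X \<and> 0 < r}"

lemma topspace_upper_ball_topology: "topspace (upper_ball_topology X d) = X"
proof -
  have "pos_diff a a = 0" for a
    using pos_diff_le_iff[of a a 0] by simp
  then have "upper_hemimetric X d x x = 0" for x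
    by (cases "X = {}") (simp_all add: upper_hemimetric_def bot_ennreal)
  then have "x \<in> {y \<in> X. upper_hemimetric X d x y < 1}" if "x \<in> X" for x
    using that by simp
  then have "X \<subseteq> topspace (upper_ball_topology X d)"
    unfolding upper_ball_topology_def topology_generated_by_topspace
    using zero_less_one[where 'a = ennreal] by blast
  moreover have "topspace (upper_ball_topology X d) \<subseteq> X"
    unfolding upper_ball_topology_def topology_generated_by_topspace by blast
  ultimately show ?thesis by blast
qed

definition d_ideals :: "'a set \<Rightarrow> ('a \<Rightarrow> 'a \<Rightarrow> ennreal) \<Rightarrow> 'a set set" where
  "d_ideals B d =
     {I. I \<subseteq> B \<and> d_directed d I \<and> closedin (upper_ball_topology B d) I}"

definition hausdorff_distance :: "('a \<Rightarrow> 'a \<Rightarrow> ennreal) \<Rightarrow> 'a set \<Rightarrow> 'a set \<Rightarrow> ennreal" where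
  "hausdorff_distance d Y Z = (INF z\<in>Z. SUP y\<in>Y. d y z)"

definition d_lower_set :: "'a set \<Rightarrow> ('a \<Rightarrow> 'a \<Rightarrow> ennreal) \<Rightarrow> 'a \<Rightarrow> 'a set" where
  "d_lower_set X d x = {y \<in> X. d y x = 0}"

text \<open>An isometry maps into the target carrier; it need not be injective.\<close>

definition isometry_between ::
  "'a set \<Rightarrow> ('a \<Rightarrow> 'a \<Rightarrow> ennreal) \<Rightarrow> 'b set \<Rightarrow> ('b \<Rightarrow> 'b \<Rightarrow> ennreal) \<Rightarrow> ('a \<Rightarrow> 'b) \<Rightarrow> bool" where
  "isometry_between X d Y e f \<longleftrightarrow>
     f \<in> X \<rightarrow> Y \<and> (\<forall>x\<in>X. \<forall>y\<in>X. e (f x) (f y) = d x y)"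

end

theory Submission
  imports Defs
begin

text \<open>
  The distance \<open>d\<close> plays the role of the way-below relation of domain theory, and the ideals
  of \<open>B\<close> form a rounded ideal completion.  Everything rests on two reductions.

  The first removes the topology.  For a directed \<open>Y\<close>, the closure of \<open>Y\<close> with respect to the
  balls of the upper hemimetric consists of the points \<open>x\<close> with \<open>(INF y\<in>Y. d x y) = 0\<close>, because a
  point that is close to \<open>y \<in> Y\<close> in the upper hemimetric is close in \<open>d\<close> to any \<open>y' \<in> Y\<close> with
  \<open>d y y'\<close> small.  So ideals are the directed sets that equal their \<open>ideal_hull\<close>, and the hull of
  any directed set is an ideal.  If \<open>x\<close> is a maximum of \<open>Y\<close>, then \<open>d z x\<close> is the infimum of
  \<open>d z y\<close> over \<open>y \<in> Y\<close>; hence the hull of \<open>Y\<close> in \<open>B\<close> is the set of all \<open>b \<in> B\<close> with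
  \<open>d b x = 0\<close>, which is therefore an ideal.

  The second is the formula \<open>hausdorff_distance_d_lower_set\<close>: the Hausdorff distance from the ideal
  of \<open>x\<close> to a directed set \<open>Z\<close> is the infimum of \<open>d x z\<close> over \<open>z \<in> Z\<close>.  It is the place where the
  inequality between the hemimetrics enters: the supremum of \<open>d b z\<close> over the ideal of \<open>x\<close> is the
  lower hemimetric from \<open>x\<close> to \<open>z\<close>, so it bounds the upper one, which in turn controls \<open>d x z'\<close>
  for \<open>z' \<in> Z\<close> beyond \<open>z\<close>.  Taking for \<open>Z\<close> the ideal of \<open>y\<close> gives the isometry.

  A basis of a predomain is itself a predomain, so the ideals can be studied inside \<open>B\<close> alone.
  There the isometry embeds \<open>B\<close> into its ideals, and an ideal \<open>I\<close> is the maximum of the ideals of its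
  elements, which yields continuity; a directed family of ideals has the hull of its union as a
  maximum, which yields completeness.  Finally, a surjective isometry carries completeness
  back to \<open>X\<close>; conversely, if \<open>X\<close> is complete, then an ideal has a maximum \<open>x\<close> in \<open>X\<close> and, being its
  own hull, is the ideal of \<open>x\<close>.
\<close>

section \<open>Distances and directed sets\<close>

text \<open>
  An inequality with an error term survives passing to the infimum of the errors, since
  \<open>pos_diff a b\<close> is then a lower bound of them.  This replaces most arguments with an epsilon.
\<close>

lemma le_add_INF:
  fixes a b :: ennreal
  assumes "\<And>y. y \<in> Y \<Longrightarrow> a \<le> b + f y"
  shows "a \<le> b + (INF y\<in>Y. f y)"
  using assms unfolding pos_diff_le_iff[symmetric] by (rule INF_greatest)

lemma ennreal_half_less:
  fixes e :: ennreal
  assumes "0 < e"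
  obtains s where "0 < s" "s + s < e"
proof -
  obtain r where r: "0 < r" "r < e" using assms dense by blast
  have "r / 2 + r / 2 = r * 2 / 2"
    by (simp add: mult_2_right add_divide_distrib_ennreal)
  also have "\<dots> = r" by (rule mult_divide_eq_ennreal) simp_all
  finally have "r / 2 + r / 2 < e" using r(2) by simp
  moreover have "0 < r / 2" using r(1) by (simp add: ennreal_zero_less_divide)
  ultimately show thesis by (rule that[rotated])
qed

lemma le_if_INF_zero:
  fixes a b :: ennreal
  assumes "(INF y\<in>Y. f y) = 0" "\<And>y. y \<in> Y \<Longrightarrow> a \<le> b + f y"
  shows "a \<le> b"
  using le_add_INF[where f = f and Y = Y, OF assms(2)] assms(1) by simp

lemma INF_eq_zero_iff:
  fixes f :: "'a \<Rightarrow> ennreal"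
  shows "(INF y\<in>Y. f y) = 0 \<longleftrightarrow> (\<forall>e>0. \<exists>y\<in>Y. f y < e)"
proof -
  have "(INF y\<in>Y. f y) = 0 \<longleftrightarrow> (\<forall>e>0. (INF y\<in>Y. f y) < e)"
    by (metis less_irrefl not_gr_zero)
  then show ?thesis by (simp add: INF_less_iff)
qed

lemma distance_onD:
  "distance_on X d \<Longrightarrow> x \<in> X \<Longrightarrow> y \<in> X \<Longrightarrow> z \<in> X \<Longrightarrow> d x z \<le> d x y + d y z"
  by (simp add: distance_on_def)

lemma upper_hemimetric_le_iff:
  "upper_hemimetric X d x z \<le> c \<longleftrightarrow> (\<forall>y\<in>X. d x y \<le> d z y + c)"
  by (simp add: upper_hemimetric_def SUP_le_iff pos_diff_le_iff)

lemma lower_hemimetric_le_iff: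
  "lower_hemimetric X d z y \<le> c \<longleftrightarrow> (\<forall>x\<in>X. d x y \<le> d x z + c)"
  by (simp add: lower_hemimetric_def SUP_le_iff pos_diff_le_iff)

lemma le_add_upper_hemimetric: "y \<in> X \<Longrightarrow> d x y \<le> d z y + upper_hemimetric X d x z"
  using upper_hemimetric_le_iff[of X d x z "upper_hemimetric X d x z"] by simp

lemma le_add_lower_hemimetric: "x \<in> X \<Longrightarrow> d x y \<le> d x z + lower_hemimetric X d z y"
  using lower_hemimetric_le_iff[of X d z y "lower_hemimetric X d z y"] by simp

lemma upper_hemimetric_triangle:
  "upper_hemimetric X d x z \<le> upper_hemimetric X d x y + upper_hemimetric X d y z"
  unfolding upper_hemimetric_le_iff
proof
  fix w assume w: "w \<in> X"
  have "d x w \<le> d y w + upper_hemimetric X d x y"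
    using w by (rule le_add_upper_hemimetric)
  also have "\<dots> \<le> (d z w + upper_hemimetric X d y z) + upper_hemimetric X d x y"
    using w by (intro add_right_mono le_add_upper_hemimetric)
  finally show "d x w \<le> d z w + (upper_hemimetric X d x y + upper_hemimetric X d y z)"
    by (simp add: ac_simps)
qed

lemma upper_hemimetric_self: "upper_hemimetric X d x x = 0"
  using upper_hemimetric_le_iff[of X d x x 0] by simp

lemma upper_hemimetric_le_distance:
  "distance_on X d \<Longrightarrow> x \<in> X \<Longrightarrow> y \<in> X \<Longrightarrow> upper_hemimetric X d x y \<le> d x y"
  unfolding upper_hemimetric_le_iff by (metis add.commute distance_onD)

lemma d_directed_iff:
  "d_directed d Y \<longleftrightarrow> (\<forall>F e. finite F \<and> F \<subseteq> Y \<and> 0 < e \<longrightarrow> (\<exists>y\<in>Y. \<forall>z\<in>F. d z y < e))"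
proof -
  have "(SUP z\<in>F. d z y) < e \<longleftrightarrow> (\<forall>z\<in>F. d z y < e)" if "finite F" "0 < e" for F y and e :: ennreal
    using that by (cases "F = {}") (simp_all add: bot_ennreal finite_Sup_less_iff)
  then show ?thesis
    unfolding d_directed_def INF_eq_zero_iff by auto
qed

lemma d_directedE:
  assumes "d_directed d Y" "finite F" "F \<subseteq> Y" "0 < e"
  obtains y where "y \<in> Y" "\<And>z. z \<in> F \<Longrightarrow> d z y < e"
  using assms(1)[unfolded d_directed_iff, rule_format, of F e] assms(2-4) by auto

lemma d_directed_INF_zero: "d_directed d Y \<Longrightarrow> z \<in> Y \<Longrightarrow> (INF y\<in>Y. d z y) = 0"
  unfolding d_directed_def by (drule spec[of _ "{z}"]) simp

lemma d_directed_image: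
  assumes "\<And>x y. x \<in> Y \<Longrightarrow> y \<in> Y \<Longrightarrow> e (f x) (f y) = d x y"
    and "d_directed d Y"
  shows "d_directed e (f ` Y)"
  unfolding d_directed_iff
proof (intro allI impI)
  fix F and r :: ennreal
  assume "finite F \<and> F \<subseteq> f ` Y \<and> 0 < r"
  then obtain G where G: "finite G" "G \<subseteq> Y" "F = f ` G" "0 < r"
    by (metis finite_subset_image)
  then obtain y where y: "y \<in> Y" "\<And>z. z \<in> G \<Longrightarrow> d z y < r"
    using d_directedE[OF assms(2)] by metis
  have "\<forall>z\<in>F. e z (f y) < r"
    using G(2,3) y assms(1) by (auto simp: subset_iff)
  then show "\<exists>y\<in>f ` Y. \<forall>z\<in>F. e z y < r"
    using y(1) by blast
qed

text \<open>
  The triangle inequality through \<open>y \<in> Y\<close>, where \<open>d y x = 0\<close>, turns the inequality in the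
  definition of a maximum into an equation.
\<close>

lemma d_maximum_INF:
  assumes "distance_on X d" "Y \<subseteq> X" "is_d_maximum X d Y x" "z \<in> X"
  shows "(INF y\<in>Y. d z y) = d z x"
proof (rule antisym)
  show "(INF y\<in>Y. d z y) \<le> d z x"
    using assms(3,4) by (simp add: is_d_maximum_def)
  show "d z x \<le> (INF y\<in>Y. d z y)"
  proof (rule INF_greatest)
    fix y assume "y \<in> Y"
    with assms(2-4) have "d z x \<le> d z y + d y x" "d y x = 0"
      using distance_onD[OF assms(1), of z y x] by (auto simp: is_d_maximum_def)
    then show "d z x \<le> d z y" by simp
  qed
qed

section \<open>Ideals and ideal hulls\<close>

text \<open>
  For directed \<open>Y \<subseteq> B\<close> this is the closure of \<open>Y\<close> in the ball topology, described by \<open>d\<close> in place of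
  the upper hemimetric.
\<close>

definition ideal_hull :: "'a set \<Rightarrow> ('a \<Rightarrow> 'a \<Rightarrow> ennreal) \<Rightarrow> 'a set \<Rightarrow> 'a set" where
  "ideal_hull B d Y = {x \<in> B. (INF y\<in>Y. d x y) = 0}"

text \<open>
  The triangle inequality of the upper hemimetric makes the subbasic balls a basis: every point of
  a ball is the centre of a smaller ball inside it, so balls about \<open>x\<close> are enough to test openness
  at \<open>x\<close>.
\<close>

lemma openin_upper_ball_topology:
  "openin (upper_ball_topology X d) U \<longleftrightarrow>
     U \<subseteq> X \<and> (\<forall>x\<in>U. \<exists>r>0. {y \<in> X. upper_hemimetric X d x y < r} \<subseteq> U)"
    (is "_ \<longleftrightarrow> ?nbhd U")
proof
  assume "openin (upper_ball_topology X d) U"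
  then have "generate_topology_on
      {{x \<in> X. upper_hemimetric X d c x < r} |c r. c \<in> X \<and> 0 < r} U"
    unfolding upper_ball_topology_def openin_topology_generated_by_iff .
  then show "?nbhd U"
  proof induction
    case (Int U V)
    show ?case
    proof (intro conjI ballI)
      fix x assume x: "x \<in> U \<inter> V"
      obtain r s where "r > 0" "{y \<in> X. upper_hemimetric X d x y < r} \<subseteq> U"
        "s > 0" "{y \<in> X. upper_hemimetric X d x y < s} \<subseteq> V"
        using Int.IH x by (meson IntD1 IntD2)
      then show "\<exists>r>0. {y \<in> X. upper_hemimetric X d x y < r} \<subseteq> U \<inter> V"
        by (intro exI[of _ "min r s"]) auto
    qed (use Int.IH in blast)
  next
    case (UN K)
    then show ?case by (meson Sup_least Union_upper UnionE order_trans)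
  next
    case (Basis U)
    then obtain c r where U: "U = {x \<in> X. upper_hemimetric X d c x < r}"
      by blast
    show ?case
    proof (intro conjI ballI)
      fix x assume "x \<in> U"
      then have less: "upper_hemimetric X d c x < r" by (simp add: U)
      define s where "s = r - upper_hemimetric X d c x"
      have "{y \<in> X. upper_hemimetric X d x y < s} \<subseteq> U"
      proof
        fix y assume y: "y \<in> {y \<in> X. upper_hemimetric X d x y < s}"
        have "upper_hemimetric X d c y \<le> upper_hemimetric X d c x + upper_hemimetric X d x y"
          by (rule upper_hemimetric_triangle)
        also have "\<dots> < r"
          using y less less_diff_eq_ennreal[of r "upper_hemimetric X d c x" "upper_hemimetric X d x y"]
            order_less_le_trans[OF less top_greatest]
          by (simp add: s_def add.commute)
        finally show "y \<in> U" using y by (simp add: U)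
      qed
      moreover have "0 < s" using less by (simp add: s_def diff_gr0_ennreal)
      ultimately show "\<exists>r>0. {y \<in> X. upper_hemimetric X d x y < r} \<subseteq> U" by blast
    qed (auto simp: U)
  qed simp
next
  assume nbhd: "?nbhd U"
  show "openin (upper_ball_topology X d) U"
    unfolding openin_subopen[of _ U]
  proof
    fix x assume "x \<in> U"
    with nbhd obtain r where r: "r > 0" "{y \<in> X. upper_hemimetric X d x y < r} \<subseteq> U" "x \<in> X"
      by blast
    have "openin (upper_ball_topology X d) {y \<in> X. upper_hemimetric X d x y < r}"
      unfolding upper_ball_topology_def
      using r by (intro topology_generated_by_Basis) blast
    with r show "\<exists>T. openin (upper_ball_topology X d) T \<and> x \<in> T \<and> T \<subseteq> U"
      by (metis (mono_tags, lifting) mem_Collect_eq upper_hemimetric_self)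
  qed
qed

lemma closedin_upper_ball_topology:
  "closedin (upper_ball_topology X d) I \<longleftrightarrow>
     I \<subseteq> X \<and> (\<forall>x\<in>X. (INF y\<in>I. upper_hemimetric X d x y) = 0 \<longrightarrow> x \<in> I)"
proof -
  have "(\<exists>r>0. {y \<in> X. upper_hemimetric X d x y < r} \<subseteq> X - I) \<longleftrightarrow>
      (INF y\<in>I. upper_hemimetric X d x y) \<noteq> 0" if "I \<subseteq> X" for x
    unfolding INF_eq_zero_iff using that by blast
  then show ?thesis
    unfolding closedin_def topspace_upper_ball_topology openin_upper_ball_topology by blast
qed

text \<open>
  One direction holds because the upper hemimetric is at most \<open>d\<close>.  For the other, a small upper
  hemimetric from \<open>x\<close> to \<open>y \<in> Y\<close> does not bound \<open>d x y\<close>, as \<open>d y y\<close> can be large; directedness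
  provides \<open>y' \<in> Y\<close> with \<open>d y y'\<close> small, and then \<open>d x y'\<close> is small.
\<close>

lemma INF_upper_hemimetric_zero_iff:
  assumes d: "distance_on B d" and Y: "Y \<subseteq> B" "d_directed d Y" and x: "x \<in> B"
  shows "(INF y\<in>Y. upper_hemimetric B d x y) = 0 \<longleftrightarrow> (INF y\<in>Y. d x y) = 0"
proof
  assume u: "(INF y\<in>Y. upper_hemimetric B d x y) = 0"
  have "(INF y\<in>Y. d x y) \<le> 0 + upper_hemimetric B d x y" if y: "y \<in> Y" for y
  proof (rule le_if_INF_zero[OF d_directed_INF_zero[OF Y(2) y]])
    fix y' assume y': "y' \<in> Y"
    then have "(INF y\<in>Y. d x y) \<le> d x y'" by (rule INF_lower)
    also have "\<dots> \<le> d y y' + upper_hemimetric B d x y"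
      using y' Y(1) by (intro le_add_upper_hemimetric) blast
    finally show "(INF y\<in>Y. d x y) \<le> 0 + upper_hemimetric B d x y + d y y'"
      by (simp add: add.commute)
  qed
  with u have "(INF y\<in>Y. d x y) \<le> 0" by (rule le_if_INF_zero)
  then show "(INF y\<in>Y. d x y) = 0" by simp
next
  assume d0: "(INF y\<in>Y. d x y) = 0"
  have "(INF y\<in>Y. upper_hemimetric B d x y) \<le> (INF y\<in>Y. d x y)"
    using Y(1) x by (intro INF_mono) (auto intro: upper_hemimetric_le_distance[OF d])
  then show "(INF y\<in>Y. upper_hemimetric B d x y) = 0" using d0 by simp
qed

lemma d_ideals_iff:
  assumes "distance_on B d"
  shows "I \<in> d_ideals B d \<longleftrightarrow> I \<subseteq> B \<and> d_directed d I \<and> ideal_hull B d I = I"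
proof -
  have "closedin (upper_ball_topology B d) I \<longleftrightarrow> ideal_hull B d I = I"
    if I: "I \<subseteq> B" "d_directed d I"
  proof -
    have "closedin (upper_ball_topology B d) I \<longleftrightarrow> ideal_hull B d I \<subseteq> I"
      unfolding closedin_upper_ball_topology ideal_hull_def
      using I INF_upper_hemimetric_zero_iff[OF assms I] by auto
    moreover have "I \<subseteq> ideal_hull B d I"
      unfolding ideal_hull_def using I d_directed_INF_zero[OF I(2)] by auto
    ultimately show ?thesis by blast
  qed
  then show ?thesis unfolding d_ideals_def by blast
qed

lemma subset_ideal_hull: "Y \<subseteq> B \<Longrightarrow> d_directed d Y \<Longrightarrow> Y \<subseteq> ideal_hull B d Y"
  unfolding ideal_hull_def by (auto simp: d_directed_INF_zero)

lemma INF_ideal_hull: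
  assumes d: "distance_on B d" and Y: "Y \<subseteq> B" "d_directed d Y" and x: "x \<in> B"
  shows "(INF y\<in>ideal_hull B d Y. d x y) = (INF y\<in>Y. d x y)"
proof (rule antisym)
  show "(INF y\<in>ideal_hull B d Y. d x y) \<le> (INF y\<in>Y. d x y)"
    using subset_ideal_hull[OF Y] by (rule INF_superset_mono) simp
  show "(INF y\<in>Y. d x y) \<le> (INF y\<in>ideal_hull B d Y. d x y)"
  proof (rule INF_greatest)
    fix y assume y: "y \<in> ideal_hull B d Y"
    then have "(INF z\<in>Y. d y z) = 0" by (simp add: ideal_hull_def)
    then show "(INF y\<in>Y. d x y) \<le> d x y"
    proof (rule le_if_INF_zero)
      fix z assume z: "z \<in> Y"
      then have "(INF y\<in>Y. d x y) \<le> d x z" by (rule INF_lower)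
      also have "\<dots> \<le> d x y + d y z"
        using y z x Y(1) by (intro distance_onD[OF d]) (auto simp: ideal_hull_def)
      finally show "(INF y\<in>Y. d x y) \<le> d x y + d y z" .
    qed
  qed
qed

text \<open>
  Replace each of finitely many points of the hull by a nearby element of \<open>Y\<close> and apply directedness
  of \<open>Y\<close> to those.
\<close>

lemma ideal_hull_directed:
  assumes d: "distance_on B d" and Y: "Y \<subseteq> B" "d_directed d Y"
  shows "d_directed d (ideal_hull B d Y)"
  unfolding d_directed_def
proof (intro allI impI)
  fix F assume F: "finite F \<and> F \<subseteq> ideal_hull B d Y"
  show "(INF y\<in>ideal_hull B d Y. SUP z\<in>F. d z y) = 0"
    unfolding INF_eq_zero_iff
  proof (intro allI impI)
    fix e :: ennreal assume "0 < e"
    then obtain s where s: "0 < s" "s + s < e" by (rule ennreal_half_less)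
    have "\<forall>z\<in>F. \<exists>y\<in>Y. d z y < s"
      using F s(1) by (auto simp: ideal_hull_def INF_eq_zero_iff)
    then obtain g where g: "\<And>z. z \<in> F \<Longrightarrow> g z \<in> Y \<and> d z (g z) < s" by metis
    obtain y where y: "y \<in> Y" "\<And>w. w \<in> g ` F \<Longrightarrow> d w y < s"
      using d_directedE[OF Y(2), of "g ` F" s] F g s(1) by blast
    have "(SUP z\<in>F. d z y) \<le> s + s"
    proof (rule SUP_least)
      fix z assume z: "z \<in> F"
      then have "d z y \<le> d z (g z) + d (g z) y"
        using F g y(1) Y(1) by (intro distance_onD[OF d]) (auto simp: ideal_hull_def)
      also have "\<dots> \<le> s + s"
        using z g y(2) by (intro add_mono) (auto intro: less_imp_le)
      finally show "d z y \<le> s + s" .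
    qed
    with s(2) subset_ideal_hull[OF Y] y(1)
    show "\<exists>y\<in>ideal_hull B d Y. (SUP z\<in>F. d z y) < e"
      by (meson le_less_trans subsetD)
  qed
qed

lemma ideal_hull_in_d_ideals:
  assumes "distance_on B d" "Y \<subseteq> B" "d_directed d Y"
  shows "ideal_hull B d Y \<in> d_ideals B d"
proof -
  have "ideal_hull B d (ideal_hull B d Y) = ideal_hull B d Y"
    unfolding ideal_hull_def[of B d "ideal_hull B d Y"]
    using INF_ideal_hull[OF assms] by (auto simp: ideal_hull_def)
  then show ?thesis
    using ideal_hull_directed[OF assms] by (auto simp: d_ideals_iff[OF assms(1)] ideal_hull_def)
qed

section \<open>Bases of predomains\<close>

lemma distance_on_subset: "distance_on X d \<Longrightarrow> B \<subseteq> X \<Longrightarrow> distance_on B d"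
  unfolding distance_on_def by blast

lemma max_basis_subset: "max_basis X d B \<Longrightarrow> B \<subseteq> X"
  by (simp add: max_basis_def)

lemma max_predomain_distance: "max_predomain X d \<Longrightarrow> distance_on X d"
  by (simp add: max_predomain_def)

lemma max_predomain_basis: "max_predomain X d \<Longrightarrow> max_basis X d X"
  by (simp add: max_predomain_def max_continuous_def)

lemma max_predomain_hemimetrics:
  "max_predomain X d \<Longrightarrow> x \<in> X \<Longrightarrow> y \<in> X \<Longrightarrow>
     upper_hemimetric X d x y \<le> lower_hemimetric X d x y"
  by (simp add: max_predomain_def)

lemma d_lower_set_Int: "B \<subseteq> X \<Longrightarrow> d_lower_set X d x \<inter> B = d_lower_set B d x"
  by (auto simp: d_lower_set_def)

lemma ideal_hull_eq_d_lower_set: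
  assumes "distance_on X d" "B \<subseteq> X" "Y \<subseteq> X" "is_d_maximum X d Y x"
  shows "ideal_hull B d Y = d_lower_set B d x"
  using d_maximum_INF[OF assms(1,3,4)] assms(2)
  by (auto simp: ideal_hull_def d_lower_set_def)

lemma d_lower_set_ideal:
  assumes d: "distance_on X d" and B: "max_basis X d B" and x: "x \<in> X"
  shows "d_lower_set B d x \<in> d_ideals B d"
    and "is_d_maximum X d (d_lower_set B d x) x"
proof -
  note BX = max_basis_subset[OF B]
  obtain Y where Y: "Y \<subseteq> B" "d_directed d Y" and max: "is_d_maximum X d Y x"
    using B x unfolding max_basis_def by blast
  have eq: "ideal_hull B d Y = d_lower_set B d x"
    using ideal_hull_eq_d_lower_set[OF d BX _ max] Y(1) BX by blast
  show "d_lower_set B d x \<in> d_ideals B d"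
    using ideal_hull_in_d_ideals[OF distance_on_subset[OF d BX] Y] unfolding eq .
  have "(INF y\<in>d_lower_set B d x. d z y) \<le> d z x" if z: "z \<in> X" for z
  proof -
    have "(INF y\<in>d_lower_set B d x. d z y) \<le> (INF y\<in>Y. d z y)"
      using subset_ideal_hull[OF Y] unfolding eq by (rule INF_superset_mono) simp
    also have "\<dots> \<le> d z x" using max z by (simp add: is_d_maximum_def)
    finally show ?thesis .
  qed
  then show "is_d_maximum X d (d_lower_set B d x) x"
    using x by (auto simp: is_d_maximum_def d_lower_set_def)
qed

lemma INF_d_lower_set:
  assumes "distance_on X d" "max_basis X d B" "x \<in> X" "z \<in> X"
  shows "(INF b\<in>d_lower_set B d x. d z b) = d z x"
proof (rule d_maximum_INF[OF assms(1) _ d_lower_set_ideal(2)[OF assms(1-3)] assms(4)])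
  show "d_lower_set B d x \<subseteq> X"
    using max_basis_subset[OF assms(2)] by (auto simp: d_lower_set_def)
qed

text \<open>
  To compare \<open>d w z\<close> with \<open>d w x\<close>, pass through basis elements \<open>b\<close> below \<open>x\<close>: the
  numbers \<open>d w b\<close> approximate \<open>d w x\<close>.
\<close>

lemma lower_hemimetric_le_SUP:
  assumes d: "distance_on X d" and B: "max_basis X d B" and x: "x \<in> X" "z \<in> X"
  shows "lower_hemimetric X d x z \<le> (SUP b\<in>d_lower_set B d x. d b z)" (is "_ \<le> ?S")
  unfolding lower_hemimetric_le_iff
proof
  fix w assume w: "w \<in> X"
  have "d w z \<le> ?S + (INF b\<in>d_lower_set B d x. d w b)"
  proof (rule le_add_INF)
    fix b assume b: "b \<in> d_lower_set B d x"
    then have "d w z \<le> d w b + d b z"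
      using w x max_basis_subset[OF B] by (intro distance_onD[OF d]) (auto simp: d_lower_set_def)
    also have "\<dots> \<le> d w b + ?S" using b by (intro add_left_mono SUP_upper)
    finally show "d w z \<le> ?S + d w b" by (simp add: add.commute)
  qed
  then show "d w z \<le> d w x + ?S"
    by (simp add: INF_d_lower_set[OF d B x(1) w] add.commute)
qed

lemma upper_hemimetric_subset:
  "B \<subseteq> X \<Longrightarrow> upper_hemimetric B d x z \<le> upper_hemimetric X d x z"
  unfolding upper_hemimetric_le_iff by (auto intro: le_add_upper_hemimetric)

text \<open>
  Shrinking the carrier can only decrease both hemimetrics.  The lower one does not decrease,
  since basis elements already give its supremum, so the required inequality persists.
\<close>

lemma max_predomain_max_basis:
  assumes X: "max_predomain X d" and B: "max_basis X d B"
  shows "max_predomain B d"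
proof -
  note d = max_predomain_distance[OF X] and BX = max_basis_subset[OF B]
  have "max_basis B d B"
    using B BX unfolding max_basis_def is_d_maximum_def by (meson order_refl subsetD)
  moreover have "upper_hemimetric B d x y \<le> lower_hemimetric B d x y" if "x \<in> B" "y \<in> B" for x y
  proof -
    have xy: "x \<in> X" "y \<in> X" using that BX by auto
    have "upper_hemimetric B d x y \<le> upper_hemimetric X d x y"
      using BX by (rule upper_hemimetric_subset)
    also have "\<dots> \<le> lower_hemimetric X d x y"
      using X xy by (rule max_predomain_hemimetrics)
    also have "\<dots> \<le> (SUP b\<in>d_lower_set B d x. d b y)"
      using d B xy by (rule lower_hemimetric_le_SUP)
    also have "\<dots> \<le> lower_hemimetric B d x y"
    proof (rule SUP_least)
      fix b assume "b \<in> d_lower_set B d x"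
      then show "d b y \<le> lower_hemimetric B d x y"
        using le_add_lower_hemimetric[of b B d y x] by (simp add: d_lower_set_def)
    qed
    finally show ?thesis .
  qed
  ultimately show ?thesis
    using distance_on_subset[OF d BX] by (simp add: max_predomain_def max_continuous_def)
qed

text \<open>
  Each \<open>b\<close> below \<open>x\<close> satisfies \<open>d b z \<le> d x z\<close>, which is one inequality.  For the other, the
  supremum of \<open>d b z\<close> bounds the lower and hence the upper hemimetric from \<open>x\<close> to \<open>z\<close>; thus
  \<open>d x w\<close> exceeds this supremum by at most \<open>d z w\<close>, and directedness makes \<open>d z w\<close> small.
\<close>

lemma hausdorff_distance_d_lower_set:
  assumes X: "max_predomain X d" and B: "max_basis X d B" and x: "x \<in> X"
    and Z: "Z \<subseteq> X" "d_directed d Z"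
  shows "hausdorff_distance d (d_lower_set B d x) Z = (INF z\<in>Z. d x z)"
proof (rule antisym)
  note d = max_predomain_distance[OF X] and BX = max_basis_subset[OF B]
  show "hausdorff_distance d (d_lower_set B d x) Z \<le> (INF z\<in>Z. d x z)"
    unfolding hausdorff_distance_def
  proof (rule INF_superset_mono[OF order_refl], rule SUP_least)
    fix z b assume "z \<in> Z" "b \<in> d_lower_set B d x"
    then show "d b z \<le> d x z"
      using distance_onD[OF d, of b x z] x Z(1) BX by (auto simp: d_lower_set_def)
  qed
  show "(INF z\<in>Z. d x z) \<le> hausdorff_distance d (d_lower_set B d x) Z"
    unfolding hausdorff_distance_def
  proof (rule INF_greatest)
    fix z assume z: "z \<in> Z"
    show "(INF z\<in>Z. d x z) \<le> (SUP b\<in>d_lower_set B d x. d b z)" (is "_ \<le> ?S")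
    proof (rule le_if_INF_zero[OF d_directed_INF_zero[OF Z(2) z]])
      fix w assume w: "w \<in> Z"
      have "(INF z\<in>Z. d x z) \<le> d x w" using w by (rule INF_lower)
      also have "\<dots> \<le> d z w + upper_hemimetric X d x z"
        using w Z(1) by (intro le_add_upper_hemimetric) blast
      also have "upper_hemimetric X d x z \<le> lower_hemimetric X d x z"
        using x z Z(1) by (intro max_predomain_hemimetrics[OF X]) auto
      also have "\<dots> \<le> ?S"
        using x z Z(1) by (intro lower_hemimetric_le_SUP[OF d B]) auto
      finally show "(INF z\<in>Z. d x z) \<le> ?S + d z w"
        by (simp add: add_left_mono add.commute)
    qed
  qed
qed

lemma isometry_d_lower_set:
  assumes X: "max_predomain X d" and B: "max_basis X d B"
  shows "isometry_between X d (d_ideals B d) (hausdorff_distance d) (d_lower_set B d)"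
  unfolding isometry_between_def
proof (intro conjI funcsetI ballI)
  note d = max_predomain_distance[OF X] and BX = max_basis_subset[OF B]
  show I: "d_lower_set B d x \<in> d_ideals B d" if "x \<in> X" for x
    using d B that by (rule d_lower_set_ideal)
  fix x y assume xy: "x \<in> X" "y \<in> X"
  have "d_lower_set B d y \<subseteq> X" "d_directed d (d_lower_set B d y)"
    using I[OF xy(2)] BX by (auto simp: d_ideals_def)
  then have "hausdorff_distance d (d_lower_set B d x) (d_lower_set B d y) =
      (INF z\<in>d_lower_set B d y. d x z)"
    by (rule hausdorff_distance_d_lower_set[OF X B xy(1)])
  also have "\<dots> = d x y" using d B xy(2,1) by (rule INF_d_lower_set)
  finally show "hausdorff_distance d (d_lower_set B d x) (d_lower_set B d y) = d x y" .
qed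

section \<open>The domain of ideals\<close>

lemma SUP_le_SUP_add:
  assumes "distance_on B d" "Z \<subseteq> B" "w \<in> B" "y \<in> B"
  shows "(SUP z\<in>Z. d z y) \<le> (SUP z\<in>Z. d z w) + d w y"
proof (rule SUP_least)
  fix z assume z: "z \<in> Z"
  then have "d z y \<le> d z w + d w y" using assms by (intro distance_onD) auto
  also have "\<dots> \<le> (SUP z\<in>Z. d z w) + d w y" using z by (intro add_right_mono SUP_upper)
  finally show "d z y \<le> (SUP z\<in>Z. d z w) + d w y" .
qed

lemma distance_on_hausdorff:
  assumes d: "distance_on B d" and "\<Y> \<subseteq> Pow B"
  shows "distance_on \<Y> (hausdorff_distance d)"
  unfolding distance_on_def
proof (intro ballI)
  fix I J K assume "I \<in> \<Y>" "J \<in> \<Y>" "K \<in> \<Y>"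
  then have sub: "I \<subseteq> B" "J \<subseteq> B" "K \<subseteq> B" using assms(2) by auto
  show "hausdorff_distance d I K \<le> hausdorff_distance d I J + hausdorff_distance d J K"
    unfolding hausdorff_distance_def[of d J K]
  proof (rule le_add_INF)
    fix k assume k: "k \<in> K"
    have "hausdorff_distance d I K \<le> (SUP j\<in>J. d j k) + (INF j\<in>J. SUP i\<in>I. d i j)"
    proof (rule le_add_INF)
      fix j assume j: "j \<in> J"
      have "hausdorff_distance d I K \<le> (SUP i\<in>I. d i k)"
        unfolding hausdorff_distance_def using k by (rule INF_lower)
      also have "\<dots> \<le> (SUP i\<in>I. d i j) + d j k"
        using sub j k by (intro SUP_le_SUP_add[OF d]) auto
      also have "\<dots> \<le> (SUP i\<in>I. d i j) + (SUP j\<in>J. d j k)"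
        using j by (intro add_left_mono SUP_upper)
      finally show "hausdorff_distance d I K \<le> (SUP j\<in>J. d j k) + (SUP i\<in>I. d i j)"
        by (simp add: add.commute)
    qed
    then show "hausdorff_distance d I K \<le> hausdorff_distance d I J + (SUP j\<in>J. d j k)"
      by (simp add: hausdorff_distance_def add.commute)
  qed
qed

text \<open>
  Given finitely many points of the union, choose one member \<open>I\<close> of the family to which all the
  members containing them are close.  Then each point is close to some element of \<open>I\<close>, and
  directedness of \<open>I\<close> finishes the argument.
\<close>

lemma Union_d_directed:
  assumes d: "distance_on B d" and \<Y>: "\<Y> \<subseteq> Collect (d_directed d) \<inter> Pow B"
    and dir: "d_directed (hausdorff_distance d) \<Y>"
  shows "d_directed d (\<Union>\<Y>)"
  unfolding d_directed_def
proof (intro allI impI)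
  fix F assume F: "finite F \<and> F \<subseteq> \<Union>\<Y>"
  show "(INF y\<in>\<Union>\<Y>. SUP z\<in>F. d z y) = 0"
    unfolding INF_eq_zero_iff
  proof (intro allI impI)
    fix e :: ennreal assume "0 < e"
    then obtain s where s: "0 < s" "s + s < e" by (rule ennreal_half_less)
    have "\<forall>z\<in>F. \<exists>I. I \<in> \<Y> \<and> z \<in> I" using F by auto
    then obtain h where h: "\<And>z. z \<in> F \<Longrightarrow> h z \<in> \<Y> \<and> z \<in> h z"
      by metis
    obtain I where I: "I \<in> \<Y>" "\<And>J. J \<in> h ` F \<Longrightarrow> hausdorff_distance d J I < s"
      using d_directedE[OF dir, of "h ` F" s] F h s(1) by blast
    have "\<forall>z\<in>F. \<exists>i\<in>I. (SUP b\<in>h z. d b i) < s"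
      using I(2) by (simp add: hausdorff_distance_def INF_less_iff)
    then obtain g where g: "\<And>z. z \<in> F \<Longrightarrow> g z \<in> I \<and> (SUP b\<in>h z. d b (g z)) < s"
      by metis
    have "d_directed d I" using \<Y> I(1) by auto
    then obtain y where y: "y \<in> I" "\<And>w. w \<in> g ` F \<Longrightarrow> d w y < s"
      using d_directedE[of d I "g ` F" s] F g s(1) by blast
    have "(SUP z\<in>F. d z y) \<le> s + s"
    proof (rule SUP_least)
      fix z assume z: "z \<in> F"
      then have "h z \<in> \<Y>" "z \<in> h z" "g z \<in> I" using h g by auto
      then have "z \<in> B" "g z \<in> B" "y \<in> B" using \<Y> I(1) y(1) by blast+
      then have "d z y \<le> d z (g z) + d (g z) y" by (rule distance_onD[OF d])
      also have "d z (g z) \<le> (SUP b\<in>h z. d b (g z))"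
        using h z by (intro SUP_upper) blast
      also have "(SUP b\<in>h z. d b (g z)) + d (g z) y \<le> s + s"
        using z g y(2) by (intro add_mono) (auto intro: less_imp_le)
      finally show "d z y \<le> s + s" by (simp add: add_right_mono)
    qed
    with s(2) I(1) y(1) show "\<exists>y\<in>\<Union>\<Y>. (SUP z\<in>F. d z y) < e"
      by (meson UnionI le_less_trans)
  qed
qed

text \<open>
  The maximum is the hull of the union: passing to the hull does not change how far a set is from
  the union, and being close to the union means being close to one of its members.
\<close>

lemma max_complete_d_ideals:
  assumes d: "distance_on B d"
  shows "max_complete (d_ideals B d) (hausdorff_distance d)"
  unfolding max_complete_def
proof (intro allI impI)
  fix \<Y> assume \<Y>: "\<Y> \<subseteq> d_ideals B d \<and> d_directed (hausdorff_distance d) \<Y>"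
  have U: "\<Union>\<Y> \<subseteq> B" using \<Y> by (auto simp: d_ideals_def)
  have dir: "d_directed d (\<Union>\<Y>)"
    using \<Y> by (intro Union_d_directed[OF d]) (auto simp: d_ideals_def)
  let ?W = "ideal_hull B d (\<Union>\<Y>)"
  have sub: "\<Union>\<Y> \<subseteq> ?W" using U dir by (rule subset_ideal_hull)
  have "is_d_maximum (d_ideals B d) (hausdorff_distance d) \<Y> ?W"
    unfolding is_d_maximum_def
  proof (intro conjI ballI)
    show "?W \<in> d_ideals B d" using d U dir by (rule ideal_hull_in_d_ideals)
  next
    fix I assume I: "I \<in> \<Y>"
    have "hausdorff_distance d I ?W \<le> (INF J\<in>\<Y>. hausdorff_distance d I J)"
    proof (rule INF_greatest)
      fix J assume "J \<in> \<Y>"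
      then have "J \<subseteq> ?W" using sub by blast
      then show "hausdorff_distance d I ?W \<le> hausdorff_distance d I J"
        unfolding hausdorff_distance_def by (rule INF_superset_mono) simp
    qed
    also have "\<dots> = 0" using \<Y> I by (intro d_directed_INF_zero) auto
    finally show "hausdorff_distance d I ?W = 0" by simp
  next
    fix Z assume "Z \<in> d_ideals B d"
    then have Z: "Z \<subseteq> B" by (simp add: d_ideals_def)
    show "(INF I\<in>\<Y>. hausdorff_distance d Z I) \<le> hausdorff_distance d Z ?W"
      unfolding hausdorff_distance_def[of d Z ?W]
    proof (rule INF_greatest)
      fix w assume w: "w \<in> ?W"
      then have "(INF y\<in>\<Union>\<Y>. d w y) = 0" by (simp add: ideal_hull_def)
      then show "(INF I\<in>\<Y>. hausdorff_distance d Z I) \<le> (SUP z\<in>Z. d z w)"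
      proof (rule le_if_INF_zero)
        fix y assume "y \<in> \<Union>\<Y>"
        then obtain I where I: "y \<in> I" "I \<in> \<Y>" by blast
        have "(INF I\<in>\<Y>. hausdorff_distance d Z I) \<le> hausdorff_distance d Z I"
          using I(2) by (rule INF_lower)
        also have "\<dots> \<le> (SUP z\<in>Z. d z y)"
          unfolding hausdorff_distance_def using I(1) by (rule INF_lower)
        also have "\<dots> \<le> (SUP z\<in>Z. d z w) + d w y"
          using Z w I U by (intro SUP_le_SUP_add[OF d]) (auto simp: ideal_hull_def)
        finally show "(INF I\<in>\<Y>. hausdorff_distance d Z I) \<le> (SUP z\<in>Z. d z w) + d w y" .
      qed
    qed
  qed
  then show "\<exists>W. is_d_maximum (d_ideals B d) (hausdorff_distance d) \<Y> W" ..
qed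

text \<open>
  The distance from the ideal of \<open>b \<in> I\<close> to \<open>I\<close> vanishes by directedness of \<open>I\<close>.  If \<open>Z\<close> is near
  \<open>i \<in> I\<close>, pick \<open>b \<in> I\<close> with \<open>d i b\<close> small; since \<open>d i b\<close> is the infimum of \<open>d i w\<close> over the
  \<open>w\<close> below \<open>b\<close>, the set \<open>Z\<close> is also near the ideal of \<open>b\<close>.
\<close>

lemma d_ideal_maximum_of_principal:
  assumes B: "max_predomain B d" and I: "I \<in> d_ideals B d"
  shows "is_d_maximum (d_ideals B d) (hausdorff_distance d) (d_lower_set B d ` I) I"
  unfolding is_d_maximum_def
proof (intro conjI ballI)
  note d = max_predomain_distance[OF B] and BB = max_predomain_basis[OF B]
  have IB: "I \<subseteq> B" "d_directed d I" using I by (auto simp: d_ideals_def)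
  show "I \<in> d_ideals B d" by (rule I)
  show "hausdorff_distance d J I = 0" if J: "J \<in> d_lower_set B d ` I" for J
  proof -
    obtain b where "b \<in> I" "J = d_lower_set B d b" using J by blast
    then show ?thesis
      using hausdorff_distance_d_lower_set[OF B BB _ IB] d_directed_INF_zero[OF IB(2)] IB(1) by auto
  qed
  fix Z assume "Z \<in> d_ideals B d"
  then have Z: "Z \<subseteq> B" by (simp add: d_ideals_def)
  show "(INF J\<in>d_lower_set B d ` I. hausdorff_distance d Z J) \<le> hausdorff_distance d Z I"
    unfolding hausdorff_distance_def[of d Z I]
  proof (rule INF_greatest)
    fix i assume i: "i \<in> I"
    show "(INF J\<in>d_lower_set B d ` I. hausdorff_distance d Z J) \<le> (SUP z\<in>Z. d z i)"
      (is "?L \<le> ?S")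
    proof (rule le_if_INF_zero[OF d_directed_INF_zero[OF IB(2) i]])
      fix b assume b: "b \<in> I"
      have "?L \<le> hausdorff_distance d Z (d_lower_set B d b)"
        using b by (intro INF_lower) blast
      also have "\<dots> \<le> ?S + (INF w\<in>d_lower_set B d b. d i w)"
      proof (rule le_add_INF)
        fix w assume w: "w \<in> d_lower_set B d b"
        have "hausdorff_distance d Z (d_lower_set B d b) \<le> (SUP z\<in>Z. d z w)"
          unfolding hausdorff_distance_def using w by (rule INF_lower)
        also have "\<dots> \<le> ?S + d i w"
          using Z w i IB(1) by (intro SUP_le_SUP_add[OF d]) (auto simp: d_lower_set_def)
        finally show "hausdorff_distance d Z (d_lower_set B d b) \<le> ?S + d i w" .
      qed
      also have "(INF w\<in>d_lower_set B d b. d i w) = d i b"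
        using b i IB(1) by (intro INF_d_lower_set[OF d BB]) auto
      finally show "?L \<le> ?S + d i b" .
    qed
  qed
qed

text \<open>
  Testing the lower hemimetric \<open>c\<close> from \<open>I\<close> to \<open>K\<close> on the ideals of the elements \<open>b \<in> I\<close>, whose
  distance to \<open>I\<close> is zero, shows that \<open>K\<close> comes within \<open>c\<close> of each such \<open>b\<close>.  By the triangle
  inequality, a point that is near all of \<open>K\<close> is near all of \<open>I\<close> up to the error \<open>c\<close>.
\<close>

lemma d_ideals_hemimetrics:
  assumes B: "max_predomain B d" and I: "I \<in> d_ideals B d" and K: "K \<in> d_ideals B d"
  shows "upper_hemimetric (d_ideals B d) (hausdorff_distance d) I K
    \<le> lower_hemimetric (d_ideals B d) (hausdorff_distance d) I K" (is "_ \<le> ?c")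
  unfolding upper_hemimetric_le_iff
proof
  note d = max_predomain_distance[OF B] and BB = max_predomain_basis[OF B]
  have IB: "I \<subseteq> B" "d_directed d I" and KB: "K \<subseteq> B" "d_directed d K"
    using I K by (auto simp: d_ideals_def)
  have close: "(INF k\<in>K. d b k) \<le> ?c" if b: "b \<in> I" for b
  proof -
    have bB: "b \<in> B" using b IB by blast
    have "hausdorff_distance d (d_lower_set B d b) K
        \<le> hausdorff_distance d (d_lower_set B d b) I + ?c"
      using d_lower_set_ideal(1)[OF d BB bB] by (rule le_add_lower_hemimetric)
    then show ?thesis
      by (simp add: hausdorff_distance_d_lower_set[OF B BB bB] IB KB d_directed_INF_zero b)
  qed
  fix Z assume "Z \<in> d_ideals B d"
  then have Z: "Z \<subseteq> B" by (simp add: d_ideals_def)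
  have "hausdorff_distance d I Z \<le> ?c + (INF z\<in>Z. SUP k\<in>K. d k z)"
  proof (rule le_add_INF)
    fix z assume z: "z \<in> Z"
    have "hausdorff_distance d I Z \<le> (SUP i\<in>I. d i z)"
      unfolding hausdorff_distance_def using z by (rule INF_lower)
    also have "\<dots> \<le> ?c + (SUP k\<in>K. d k z)" (is "_ \<le> ?c + ?S")
    proof (rule SUP_least)
      fix i assume i: "i \<in> I"
      have "d i z \<le> ?S + (INF k\<in>K. d i k)"
      proof (rule le_add_INF)
        fix k assume k: "k \<in> K"
        have "d i z \<le> d i k + d k z"
          using i k z IB(1) KB(1) Z by (intro distance_onD[OF d]) auto
        also have "\<dots> \<le> d i k + ?S" using k by (intro add_left_mono SUP_upper)
        finally show "d i z \<le> ?S + d i k" by (simp add: add.commute)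
      qed
      also have "\<dots> \<le> ?S + ?c" using close[OF i] by (rule add_left_mono)
      finally show "d i z \<le> ?c + ?S" by (simp add: add.commute)
    qed
    finally show "hausdorff_distance d I Z \<le> ?c + ?S" .
  qed
  then show "hausdorff_distance d I Z \<le> hausdorff_distance d K Z + ?c"
    by (simp add: hausdorff_distance_def add.commute)
qed

lemma max_domain_d_ideals:
  assumes B: "max_predomain B d"
  shows "max_domain (d_ideals B d) (hausdorff_distance d)"
proof -
  note d = max_predomain_distance[OF B] and BB = max_predomain_basis[OF B]
  note iso = isometry_d_lower_set[OF B BB, unfolded isometry_between_def]
  have "distance_on (d_ideals B d) (hausdorff_distance d)"
    using d by (rule distance_on_hausdorff) (auto simp: d_ideals_def)
  moreover have "max_continuous (d_ideals B d) (hausdorff_distance d)"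
    unfolding max_continuous_def max_basis_def
  proof (intro conjI ballI exI)
    fix I assume I: "I \<in> d_ideals B d"
    then have IB: "I \<subseteq> B" "d_directed d I" by (auto simp: d_ideals_def)
    show "d_lower_set B d ` I \<subseteq> d_ideals B d" using iso IB(1) by blast
    show "d_directed (hausdorff_distance d) (d_lower_set B d ` I)"
      using iso IB by (intro d_directed_image[where d = d]) auto
    show "is_d_maximum (d_ideals B d) (hausdorff_distance d) (d_lower_set B d ` I) I"
      using B I by (rule d_ideal_maximum_of_principal)
  qed simp
  ultimately show ?thesis
    using d_ideals_hemimetrics[OF B] max_complete_d_ideals[OF d]
    by (simp add: max_domain_def max_predomain_def)
qed

section \<open>Surjectivity and completeness\<close>

lemma max_complete_of_surjective_isometry:
  assumes iso: "isometry_between X d Y e f" and onto: "f ` X = Y" and Y: "max_complete Y e"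
  shows "max_complete X d"
  unfolding max_complete_def
proof (intro allI impI)
  fix A assume A: "A \<subseteq> X \<and> d_directed d A"
  have ef: "e (f x) (f y) = d x y" if "x \<in> X" "y \<in> X" for x y
    using iso that by (simp add: isometry_between_def)
  have "d_directed e (f ` A)"
    using A ef by (intro d_directed_image[where d = d]) auto
  moreover have "f ` A \<subseteq> Y" using A onto by blast
  ultimately obtain x where x: "x \<in> X" "is_d_maximum Y e (f ` A) (f x)"
    using Y onto unfolding max_complete_def is_d_maximum_def by blast
  have "is_d_maximum X d A x"
    unfolding is_d_maximum_def
  proof (intro conjI ballI)
    show "x \<in> X" by (rule x)
    show "d y x = 0" if "y \<in> A" for y
      using x that A ef[of y x] by (auto simp: is_d_maximum_def)
    fix z assume z: "z \<in> X"
    have "(INF y\<in>A. d z y) = (INF y\<in>f ` A. e (f z) y)"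
      unfolding image_image using A z ef by (intro INF_cong refl) (auto simp: subset_iff)
    also have "\<dots> \<le> e (f z) (f x)" using x z onto by (auto simp: is_d_maximum_def)
    finally show "(INF y\<in>A. d z y) \<le> d z x" by (simp add: ef z x)
  qed
  then show "\<exists>x. is_d_maximum X d A x" ..
qed

lemma d_lower_set_onto_d_ideals:
  assumes d: "distance_on X d" and B: "max_basis X d B" and X: "max_complete X d"
  shows "d_lower_set B d ` X = d_ideals B d"
proof
  note BX = max_basis_subset[OF B]
  show "d_lower_set B d ` X \<subseteq> d_ideals B d" using d_lower_set_ideal(1)[OF d B] by blast
  show "d_ideals B d \<subseteq> d_lower_set B d ` X"
  proof
    fix I assume "I \<in> d_ideals B d"
    then have I: "I \<subseteq> B" "d_directed d I" "ideal_hull B d I = I"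
      by (simp_all add: d_ideals_iff[OF distance_on_subset[OF d BX]])
    have IX: "I \<subseteq> X" using I(1) BX by blast
    then obtain x where x: "is_d_maximum X d I x"
      using X I(2) unfolding max_complete_def by blast
    have "I = d_lower_set B d x"
      using ideal_hull_eq_d_lower_set[OF d BX IX x] I(3) by simp
    then show "I \<in> d_lower_set B d ` X" using x by (simp add: is_d_maximum_def)
  qed
qed

theorem theorem4p9:
  fixes X B :: "'a set" and d :: "'a \<Rightarrow> 'a \<Rightarrow> ennreal"
  assumes "distance_on X d"
    and "max_predomain X d"
    and "max_basis X d B"
  shows "max_domain (d_ideals B d) (hausdorff_distance d) \<and>
    isometry_between X d (d_ideals B d) (hausdorff_distance d) (\<lambda>x. d_lower_set X d x \<inter> B) \<and>
    ((\<lambda>x. d_lower_set X d x \<inter> B) ` X = d_ideals B d \<longleftrightarrow> max_domain X d)"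
proof -
  have eq: "(\<lambda>x. d_lower_set X d x \<inter> B) = d_lower_set B d"
    using d_lower_set_Int[OF max_basis_subset[OF assms(3)]] by blast
  have dom: "max_domain (d_ideals B d) (hausdorff_distance d)"
    using max_predomain_max_basis[OF assms(2,3)] by (rule max_domain_d_ideals)
  have iso: "isometry_between X d (d_ideals B d) (hausdorff_distance d) (d_lower_set B d)"
    using assms(2,3) by (rule isometry_d_lower_set)
  have "d_lower_set B d ` X = d_ideals B d \<longleftrightarrow> max_complete X d"
    using max_complete_of_surjective_isometry[OF iso] d_lower_set_onto_d_ideals[OF assms(1,3)] dom
    unfolding max_domain_def by blast
  then show ?thesis
    unfolding eq using dom iso assms(2) by (simp add: max_domain_def)
qed

end
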